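(* For every fixed integer $n\geq 1$, the limit below exists and \[ \lim_{h\to\infty}\frac{\psi(h,n)}{h^n}=\frac{1}{n!\,\vartheta_L(\triangle^n)} . \]
   Context: Let $h,n$ be positive integers. A subset $C=\{c_0,c_1,\ldots,c_n\}$ of a finite additive Abelian group $G$ is an $h$-basis (basis of order $h$) of $G$ if every element of $G$ can be expressed as $c_{i_1}+\cdots+c_{i_h}$ for some $0\leq i_1\leq\cdots\leq i_h\leq n$. $\psi(h,n)$ denotes the size (cardinality) of the largest finite Abelian group $G$ containing an $h$-basis (of $G$) of size $n+1$. The simplex: $\triangle^n=\{\mathbf{x}\in\mathbb{R}^n : x_i\geq 0 \text{ for all } i,\ \sum_{i=1}^n x_i\leq 1\}$, of volume $1/n!$. A (full-rank) lattice in $\mathbb{R}^n$ is a set $\mathcal{L}=\{\alpha_1\mathbf{v}_1+\cdots+\alpha_n\mathbf{v}_n:\alpha_i\in\mathbb{Z}\}$ with $\mathbf{v}_1,\ldots,\mathbf{v}_n\in\mathbb{R}^n$ linearly independent; $\det(\mathcal{L})=|\det(\mathbf{v}_1,\ldots,\mathbf{v}_n)|$. For a convex body $K\subset\mathbb{R}^n$ (compact convex set with non-empty interior), $(K,\mathcal{L})$ is a lattice covering of $\mathbb{R}^n$ if $\bigcup_{\mathbf{x}\in\mathcal{L}}(K+\mathbf{x})=\mathbb{R}^n$. Its density is $\vartheta(K,\mathcal{L})=\operatorname{vol}(K)/\det(\mathcal{L})$, and the lattice covering density of $K$ is $\vartheta_L(K)=\inf_{\mathcal{L}}\vartheta(K,\mathcal{L})$,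 the infimum being over all lattices $\mathcal{L}$ in $\mathbb{R}^n$ such that $(K,\mathcal{L})$ is a lattice covering of $\mathbb{R}^n$. *)

theory Defs
  imports "HOL-Analysis.Analysis" "HOL-Algebra.FiniteProduct"
begin

section \<open>Bases of finite abelian groups\<close>

text \<open>
  The abelian group is written multiplicatively, as usual in HOL-Algebra, so a sum of \<open>h\<close> elements
  is a \<^const>\<open>finprod\<close> over \<open>{1..h}\<close>. The summands may repeat. The group is commutative, so their
  order is irrelevant and a nondecreasing indexing of them need not be demanded.
\<close>

definition h_basis :: "('a, 'b) monoid_scheme \<Rightarrow> nat \<Rightarrow> 'a set \<Rightarrow> bool" where
  "h_basis G h C \<longleftrightarrow>
     C \<subseteq> carrier G \<and>
     (\<forall>g\<in>carrier G. \<exists>c\<in>{1..h} \<rightarrow> C. g = finprod G c {1..h})"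

text \<open>
  Every finite group is isomorphic to one whose carrier consists of natural numbers, so it suffices
  to let \<open>G\<close> range over the type \<^typ>\<open>nat monoid\<close>; see \<open>card_le_psi\<close> below. The maximum is taken over
  a finite set, which is nonempty for positive \<open>h\<close>; see \<open>finite_psi_set\<close> and \<open>psi_set_nonempty\<close>.
\<close>

definition psi_set :: "nat \<Rightarrow> nat \<Rightarrow> nat set" where
  "psi_set h n =
     {card (carrier G) | G :: nat monoid.
        comm_group G \<and> finite (carrier G) \<and> (\<exists>C. h_basis G h C \<and> card C = n + 1)}"

definition psi :: "nat \<Rightarrow> nat \<Rightarrow> nat" where
  "psi h n = Max (psi_set h n)"

lemma h_basis_card_le:
  fixes G (structure)
  assumes "comm_group G" "finite (carrier G)" "h_basis G h C"
  shows "card (carrier G) \<le> card C ^ h"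
proof -
  interpret comm_group G by fact
  have C: "C \<subseteq> carrier G"
    and rep: "\<And>g. g \<in> carrier G \<Longrightarrow> \<exists>c\<in>{1..h} \<rightarrow> C. g = finprod G c {1..h}"
    using assms(3) by (auto simp: h_basis_def)
  have finC: "finite C" using C assms(2) finite_subset by blast
  have "carrier G \<subseteq> (\<lambda>c. finprod G c {1..h}) ` ({1..h} \<rightarrow>\<^sub>E C)"
  proof
    fix g assume "g \<in> carrier G"
    then obtain c where c: "c \<in> {1..h} \<rightarrow> C" "g = finprod G c {1..h}" using rep by blast
    have "finprod G (restrict c {1..h}) {1..h} = finprod G c {1..h}"
      using c C by (intro finprod_cong') auto
    with c show "g \<in> (\<lambda>c. finprod G c {1..h}) ` ({1..h} \<rightarrow>\<^sub>E C)"
      by (intro image_eqI[of _ _ "restrict c {1..h}"]) auto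
  qed
  then have "card (carrier G) \<le> card ({1..h} \<rightarrow>\<^sub>E C)"
    by (intro surj_card_le) (auto intro: finite_PiE finC)
  then show ?thesis by (simp add: card_PiE)
qed

lemma finite_psi_set: "finite (psi_set h n)"
proof (rule finite_subset)
  show "psi_set h n \<subseteq> {..(n + 1) ^ h}"
    unfolding psi_set_def using h_basis_card_le by fastforce
qed simp

lemma psi_set_nonempty:
  assumes "h > 0"
  shows "psi_set h n \<noteq> {}"
proof -
  define G :: "nat monoid" where
    "G = \<lparr>carrier = {..n}, mult = (\<lambda>x y. (x + y) mod (n + 1)), one = 0\<rparr>"
  have sel: "carrier G = {..n}" "mult G = (\<lambda>x y. (x + y) mod (n + 1))" "one G = 0"
    by (simp_all add: G_def)
  have "comm_group G"
  proof (rule comm_groupI)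
    fix x assume "x \<in> carrier G"
    then show "\<exists>y\<in>carrier G. y \<otimes>\<^bsub>G\<^esub> x = \<one>\<^bsub>G\<^esub>"
      by (intro bexI[of _ "(n + 1 - x) mod (n + 1)"])
         (auto simp: sel mod_add_left_eq less_Suc_eq_le[symmetric])
  next
    fix x y z
    show "x \<otimes>\<^bsub>G\<^esub> y \<otimes>\<^bsub>G\<^esub> z = x \<otimes>\<^bsub>G\<^esub> (y \<otimes>\<^bsub>G\<^esub> z)"
      unfolding sel by (simp only: mod_add_left_eq mod_add_right_eq add.assoc)
  qed (auto simp: sel add.commute less_Suc_eq_le[symmetric])
  then interpret comm_group G .
  have "h_basis G h (carrier G)"
    unfolding h_basis_def
  proof (intro conjI ballI)
    fix g assume g: "g \<in> carrier G"
    have "finprod G (\<lambda>i. if 1 = i then g else \<one>\<^bsub>G\<^esub>) {1..h} = g"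
      using g assms by (intro finprod_singleton[where f = "\<lambda>_. g" and i = 1]) auto
    then show "\<exists>c\<in>{1..h} \<rightarrow> carrier G. g = finprod G c {1..h}"
      using g by (intro bexI[of _ "\<lambda>i. if 1 = i then g else \<one>\<^bsub>G\<^esub>"]) auto
  qed simp
  then have "card (carrier G) \<in> psi_set h n"
    unfolding psi_set_def using \<open>comm_group G\<close>
    by (intro CollectI exI[of _ G] conjI exI[of _ "carrier G"]) (simp_all add: sel)
  then show ?thesis by blast
qed

lemma card_le_psi:
  fixes G :: "('a, 'b) monoid_scheme" (structure)
  assumes "comm_group G" "finite (carrier G)" "h_basis G h C" "card C = n + 1"
  shows "card (carrier G) \<le> psi h n"
proof -
  interpret comm_group G by fact
  obtain f :: "'a \<Rightarrow> nat" where f: "inj_on f (carrier G)"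
    using finite_imp_inj_to_nat_seg[OF assms(2)] by blast
  define g where "g = inv_into (carrier G) f"
  have gf [simp]: "g (f x) = x" if "x \<in> carrier G" for x
    using f that by (simp add: g_def)
  define H :: "nat monoid" where
    "H = \<lparr>carrier = f ` carrier G, mult = (\<lambda>x y. f (g x \<otimes> g y)), one = f \<one>\<rparr>"
  have sel: "carrier H = f ` carrier G" "mult H = (\<lambda>x y. f (g x \<otimes> g y))" "one H = f \<one>"
    by (simp_all add: H_def)
  have "comm_group H"
  proof (rule comm_groupI)
    fix x assume "x \<in> carrier H"
    then obtain a where "a \<in> carrier G" "x = f a" by (auto simp: sel)
    then show "\<exists>y\<in>carrier H. y \<otimes>\<^bsub>H\<^esub> x = \<one>\<^bsub>H\<^esub>"
      by (intro bexI[of _ "f (inv a)"]) (auto simp: sel)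
  qed (auto simp: sel m_ac)
  then interpret H: comm_group H .
  have fp: "finprod H (\<lambda>i. f (c i)) A = f (finprod G c A)" if "c \<in> A \<rightarrow> carrier G" "finite A"
    for c :: "nat \<Rightarrow> 'a" and A
    using that(2,1) by (induction A rule: finite_induct) (auto simp: sel Pi_def)
  have C: "C \<subseteq> carrier G"
    and rep: "\<And>g. g \<in> carrier G \<Longrightarrow> \<exists>c\<in>{1..h} \<rightarrow> C. g = finprod G c {1..h}"
    using assms(3) by (auto simp: h_basis_def)
  have "h_basis H h (f ` C)"
    unfolding h_basis_def
  proof (intro conjI ballI)
    show "f ` C \<subseteq> carrier H" using C by (auto simp: sel)
    fix y assume "y \<in> carrier H"
    then obtain a where a: "a \<in> carrier G" "y = f a" by (auto simp: sel)
    then obtain c where c: "c \<in> {1..h} \<rightarrow> C" "a = finprod G c {1..h}" using rep by blast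
    moreover have "c \<in> {1..h} \<rightarrow> carrier G" using c(1) C by auto
    ultimately have "y = finprod H (\<lambda>i. f (c i)) {1..h}"
      using fp[of c "{1..h}"] a by simp
    then show "\<exists>d\<in>{1..h} \<rightarrow> f ` C. y = finprod H d {1..h}"
      using c by (intro bexI[of _ "\<lambda>i. f (c i)"]) auto
  qed
  moreover have "card (f ` C) = n + 1"
    using assms(4) C f by (metis card_image inj_on_subset)
  moreover have "card (carrier H) = card (carrier G)" "finite (carrier H)"
    using f assms(2) by (simp_all add: sel card_image)
  ultimately have "card (carrier G) \<in> psi_set h n"
    unfolding psi_set_def using \<open>comm_group H\<close> by (metis (mono_tags, lifting) mem_Collect_eq)
  then show ?thesis unfolding psi_def using finite_psi_set by (rule Max_ge[rotated])
qed


section \<open>Lattices and lattice coverings\<close>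

definition lattice_basis :: "('n::finite \<Rightarrow> real^'n) \<Rightarrow> (real^'n) set \<Rightarrow> bool" where
  "lattice_basis v L \<longleftrightarrow>
     inj v \<and> independent (range v) \<and>
     L = {(\<Sum>i\<in>UNIV. of_int (\<alpha> i) *\<^sub>R v i) | \<alpha> :: 'n \<Rightarrow> int. True}"

definition is_lattice :: "(real^'n::finite) set \<Rightarrow> bool" where
  "is_lattice L \<longleftrightarrow> (\<exists>v. lattice_basis v L)"

text \<open>The value does not depend on the choice of the lattice basis; see \<open>lattice_det_eq\<close> below.\<close>

definition lattice_det :: "(real^'n::finite) set \<Rightarrow> real" where
  "lattice_det L = (THE d. \<exists>v. lattice_basis v L \<and> d = \<bar>det (\<chi> i. v i)\<bar>)"

lemma lattice_basis_det_nonzero: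
  fixes v :: "'n::finite \<Rightarrow> real^'n"
  assumes "lattice_basis v L"
  shows "det (\<chi> i. v i) \<noteq> 0"
proof -
  have "c i = 0" if "(\<Sum>i\<in>UNIV. c i *s row i (\<chi> i. v i)) = 0" for c i
  proof -
    have inj: "inj v" and ind: "independent (range v)"
      using assms by (auto simp: lattice_basis_def)
    have "(\<Sum>x\<in>range v. c (inv_into UNIV v x) *\<^sub>R x) = (\<Sum>i\<in>UNIV. c i *\<^sub>R v i)"
      by (subst sum.reindex[OF inj]) (simp add: inj)
    also have "\<dots> = 0"
      using that by (simp add: row_def scalar_mult_eq_scaleR)
    finally have "c (inv_into UNIV v (v i)) = 0"
      using ind by (intro independentD[where u = "\<lambda>x. c (inv_into UNIV v x)"]) auto
    then show ?thesis by (simp add: inj)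
  qed
  then have "\<exists>B :: real^'n^'n. (\<chi> i. v i) ** B = mat 1"
    unfolding matrix_right_invertible_independent_rows by blast
  then show ?thesis
    by (metis invertible_det_nz invertible_right_inverse)
qed

lemma lattice_det_eq:
  fixes v :: "'n::finite \<Rightarrow> real^'n"
  assumes v: "lattice_basis v L"
  shows "lattice_det L = \<bar>det (\<chi> i. v i)\<bar>"
proof -
  have ex: "\<exists>A. (\<forall>i j. A $ i $ j \<in> \<int>) \<and> (\<chi> i. u i) = A ** (\<chi> i. w i)"
    if u: "lattice_basis u L" and w: "lattice_basis w L" for u w :: "'n \<Rightarrow> real^'n"
  proof -
    have "u i \<in> L" for i
    proof -
      have "u i = (\<Sum>j\<in>UNIV. of_int (if j = i then 1 else 0) *\<^sub>R u j)"
        by (subst sum.remove[of _ i]) (auto intro!: sum.neutral)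
      then have "\<exists>\<alpha> :: 'n \<Rightarrow> int. u i = (\<Sum>j\<in>UNIV. of_int (\<alpha> j) *\<^sub>R u j)"
        by (intro exI[of _ "\<lambda>j. if j = i then 1 else 0"])
      then show ?thesis using u unfolding lattice_basis_def by auto
    qed
    then have "\<exists>\<alpha> :: 'n \<Rightarrow> int. u i = (\<Sum>j\<in>UNIV. of_int (\<alpha> j) *\<^sub>R w j)" for i
      using w unfolding lattice_basis_def by blast
    then obtain a :: "'n \<Rightarrow> 'n \<Rightarrow> int" where a: "\<And>i. u i = (\<Sum>j\<in>UNIV. of_int (a i j) *\<^sub>R w j)"
      by metis
    show ?thesis
    proof (intro exI conjI allI)
      show "(\<chi> i. u i) = (\<chi> i j. of_int (a i j)) ** (\<chi> i. w i)"
        by (simp add: vec_eq_iff matrix_matrix_mult_def a)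
    qed simp
  qed
  have det_int: "det A \<in> \<int>" if "\<forall>i j. A $ i $ j \<in> \<int>" for A :: "real^'n^'n"
    unfolding det_def using that by (intro Ints_sum Ints_mult Ints_prod) auto
  have uniq: "\<bar>det (\<chi> i. u i)\<bar> = \<bar>det (\<chi> i. v i)\<bar>" if u: "lattice_basis u L" for u :: "'n \<Rightarrow> real^'n"
  proof -
    obtain A where A: "\<forall>i j. A $ i $ j \<in> \<int>" "(\<chi> i. u i) = A ** (\<chi> i. v i)"
      using ex[OF u v] by blast
    obtain B where B: "\<forall>i j. B $ i $ j \<in> \<int>" "(\<chi> i. v i) = B ** (\<chi> i. u i)"
      using ex[OF v u] by blast
    have dA: "det (\<chi> i. u i) = det A * det (\<chi> i. v i)"
      using A(2) by (metis det_mul)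
    have dB: "det (\<chi> i. v i) = det B * det (\<chi> i. u i)"
      using B(2) by (metis det_mul)
    have ge: "\<bar>x\<bar> \<ge> 1" if "x \<in> \<int>" "x \<noteq> 0" for x :: real
      using that Ints_nonzero_abs_ge1 by blast
    have "det A \<noteq> 0" "det B \<noteq> 0"
      using dA dB lattice_basis_det_nonzero[OF u] lattice_basis_det_nonzero[OF v] by auto
    then have "\<bar>det A\<bar> \<ge> 1" "\<bar>det B\<bar> \<ge> 1"
      using ge det_int A(1) B(1) by blast+
    then show ?thesis
      using dA dB by (metis abs_ge_zero abs_mult mult_le_cancel_right1 order_antisym not_less)
  qed
  show ?thesis
    unfolding lattice_det_def using v uniq by (intro the_equality) blast+
qed

definition lattice_covering :: "(real^'n::finite) set \<Rightarrow> (real^'n) set \<Rightarrow> bool" where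
  "lattice_covering K L \<longleftrightarrow> (\<Union>x\<in>L. (\<lambda>y. y + x) ` K) = UNIV"

definition covering_density :: "(real^'n::finite) set \<Rightarrow> (real^'n) set \<Rightarrow> real" where
  "covering_density K L = measure lebesgue K / lattice_det L"

definition lattice_covering_density :: "(real^'n::finite) set \<Rightarrow> real" where
  "lattice_covering_density K =
     Inf {covering_density K L | L. is_lattice L \<and> lattice_covering K L}"

definition simplex_body :: "(real^'n::finite) set" where
  "simplex_body = {x. (\<forall>i. x $ i \<ge> 0) \<and> (\<Sum>i\<in>UNIV. x $ i) \<le> 1}"

end

theory Submission
  imports Defs "HOL-Algebra.Coset"
begin

text \<open>
  Write \<open>n\<close> for the dimension and let \<open>M\<close> be the supremum of the determinants of the lattices that
  cover \<open>\<real>\<^sup>n\<close> with the unit simplex. The simplex has volume \<open>1/n!\<close>, so the right-hand side of the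
  theorem is \<open>M\<close>, provided that \<open>M\<close> is finite: otherwise the covering density would be \<open>0\<close>.

  The link between the two sides is a dictionary. Choose a base point \<open>c\<^sub>0\<close> of an \<open>h\<close>-basis
  \<open>c\<^sub>0, \<dots>, c\<^sub>n\<close> of \<open>G\<close> and send the \<open>i\<close>th unit vector to \<open>c\<^sub>i - c\<^sub>0\<close>. This is a homomorphism from
  \<open>\<int>\<^sup>n\<close> to \<open>G\<close>, and the basis property says that every residue class modulo its kernel \<open>\<Lambda>\<close> meets
  the dilated simplex of size \<open>h\<close> (\<open>h_basis_kernel\<close>). Conversely, a subgroup \<open>\<Lambda>\<close> of \<open>\<int>\<^sup>n\<close> with the
  latter property yields an \<open>h\<close>-basis of \<open>\<int>\<^sup>n/\<Lambda>\<close>, made up of the classes of \<open>0\<close> and the unit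
  vectors (\<open>lattice_det_le_psi\<close>). In both directions the order of the group is the index of \<open>\<Lambda>\<close>, and
  this index is \<open>det \<Lambda>\<close> (\<open>residue_system\<close>), which is seen from a triangular basis.

  Upper bound: if the simplex of size \<open>h\<close> reaches every integer point modulo \<open>\<Lambda>\<close>, then the simplex of
  size \<open>h + n\<close> reaches every real point, because it leaves room for the fractional parts. Scaling by
  \<open>1/(h + n)\<close> gives a covering lattice of the unit simplex, whence \<open>\<psi>(h,n) \<le> M (h + n)\<^sup>n\<close>
  (\<open>scaled_lattice_covering\<close>).

  Lower bound: given a covering lattice \<open>L\<close> with basis \<open>v\<close>, round the vectors \<open>m v\<^sub>i\<close>, where \<open>h - m\<close> is
  a suitable constant, to integer vectors. The rounding moves points by a bounded amount, which the
  difference \<open>h - m\<close> absorbs, so that the rounded lattice still has the covering property with the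
  simplex of size \<open>h\<close> (\<open>rounded_lattice_covers\<close>). Its determinant divided by \<open>h\<^sup>n\<close> tends to \<open>det L\<close>,
  so \<open>\<psi>(h,n)/h\<^sup>n\<close> is eventually larger than every number below \<open>M\<close>. The same approximation shows that
  \<open>M\<close> is finite: the simplex of size \<open>h\<close> contains at most \<open>(h + 1)\<^sup>n\<close> integer points, so the
  rounded lattice has at most this determinant, and \<open>det L \<le> 1\<close> in the limit.
\<close>

section \<open>Subgroups of finite index in the integer points\<close>

lemma lattice_basisI:
  fixes v :: "'n::finite \<Rightarrow> real^'n"
  assumes "det (\<chi> i. v i) \<noteq> 0"
  shows "lattice_basis v {(\<Sum>i\<in>UNIV. of_int (\<alpha> i) *\<^sub>R v i) | \<alpha> :: 'n \<Rightarrow> int. True}"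
proof -
  let ?A = "\<chi> i. v i"
  have "inj v"
  proof (rule injI, rule ccontr)
    fix i j assume "v i = v j" "i \<noteq> j"
    then have "row i ?A = row j ?A" by (simp add: row_def)
    with \<open>i \<noteq> j\<close> assms show False using det_identical_rows by blast
  qed
  moreover have "rows ?A = range v"
    unfolding rows_def row_def by auto
  then have "independent (range v)"
    using det_dependent_rows[of ?A] assms by (auto simp: dependent_vec_eq)
  ultimately show ?thesis by (simp add: lattice_basis_def)
qed

text \<open>
  The index type carries no order, so triangularity is expressed by an injective rank. A permutation
  that never raises the rank is the identity, by induction on the rank; hence only the diagonal term
  of the Leibniz formula survives.
\<close>

lemma det_triangular_rank:
  fixes A :: "real^'n::finite^'n" and rank :: "'n \<Rightarrow> nat"
  assumes inj: "inj rank" and tri: "\<And>i j. rank i < rank j \<Longrightarrow> A $ i $ j = 0"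
  shows "det A = (\<Prod>i\<in>UNIV. A $ i $ i)"
proof -
  have "(\<Prod>i\<in>UNIV. A $ i $ p i) = 0" if p: "p permutes UNIV" "p \<noteq> id" for p
  proof (rule ccontr)
    assume "(\<Prod>i\<in>UNIV. A $ i $ p i) \<noteq> 0"
    then have le: "rank (p i) \<le> rank i" for i
      using tri[of i "p i"] by (force simp: not_less)
    have "p i = i" for i
    proof (induction "rank i" arbitrary: i rule: less_induct)
      case less
      show ?case
      proof (cases "rank (p i) = rank i")
        case True
        then show ?thesis using inj by (simp add: inj_eq)
      next
        case False
        then have "p (p i) = p i" using less le[of i] by simp
        then show ?thesis using p(1) by (metis permutes_inj inj_eq)
      qed
    qed
    with p(2) show False by auto
  qed
  then have "det A = (\<Sum>p\<in>{id}. of_int (sign p) * (\<Prod>i\<in>UNIV. A $ i $ p i))"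
    unfolding det_def
    by (intro sum.mono_neutral_right) (auto simp: permutes_id)
  then show ?thesis by simp
qed

definition int_points :: "(real^'n::finite) set" where
  "int_points = {x. \<forall>i. x $ i \<in> \<int>}"

locale integer_subgroup =
  fixes \<Lambda> :: "(real^'n::finite) set"
  assumes sub: "\<Lambda> \<subseteq> int_points"
    and zero: "0 \<in> \<Lambda>"
    and diff: "x \<in> \<Lambda> \<Longrightarrow> y \<in> \<Lambda> \<Longrightarrow> x - y \<in> \<Lambda>"
begin

lemma uminus: "x \<in> \<Lambda> \<Longrightarrow> - x \<in> \<Lambda>"
  using diff[of 0 x] zero by simp

lemma plus: "x \<in> \<Lambda> \<Longrightarrow> y \<in> \<Lambda> \<Longrightarrow> x + y \<in> \<Lambda>"
  using diff[of x "- y"] uminus by simp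

lemma of_nat_scale: "x \<in> \<Lambda> \<Longrightarrow> real k *\<^sub>R x \<in> \<Lambda>"
  by (induction k) (auto simp: zero plus scaleR_left_distrib)

lemma of_int_scale: "x \<in> \<Lambda> \<Longrightarrow> real_of_int k *\<^sub>R x \<in> \<Lambda>"
  using of_nat_scale[of x "nat k"] of_nat_scale[of "- x" "nat (- k)"] uminus[of x]
  by (cases "k \<ge> 0") auto

lemma sum_mem: "finite I \<Longrightarrow> (\<And>i. i \<in> I \<Longrightarrow> f i \<in> \<Lambda>) \<Longrightarrow> sum f I \<in> \<Lambda>"
  by (induction I rule: finite_induct) (auto simp: zero plus)

end

text \<open>
  The condition on the unit vectors expresses that \<open>\<Lambda>\<close> has finite index in the group of integer
  points, in the form in which the construction of a basis uses it.
\<close>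

locale integer_lattice = integer_subgroup +
  assumes multiple: "\<exists>k>0. real k *\<^sub>R axis i 1 \<in> \<Lambda>"
begin

text \<open>
  Among the members of \<open>\<Lambda>\<close> that vanish in all coordinates of rank above that of \<open>k\<close>, take one with the
  least positive \<open>k\<close>th coordinate \<open>d\<close>. The vectors obtained in this way for all \<open>k\<close> form the triangular
  basis below, and the \<open>d\<close> are its diagonal.
\<close>

lemma triangular_vector:
  fixes rank :: "'a \<Rightarrow> nat" and k :: 'a
  shows "\<exists>u d. u \<in> \<Lambda> \<and> d > 0 \<and> u $ k = real d \<and> (\<forall>j. rank k < rank j \<longrightarrow> u $ j = 0) \<and>
    (\<forall>w\<in>\<Lambda>. (\<forall>j. rank k < rank j \<longrightarrow> w $ j = 0) \<longrightarrow> w $ k \<ge> 0 \<longrightarrow> w $ k < d \<longrightarrow> w $ k = 0)"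
proof -
  define P where "P d \<longleftrightarrow> d > 0 \<and> (\<exists>u\<in>\<Lambda>. u $ k = real d \<and> (\<forall>j. rank k < rank j \<longrightarrow> u $ j = 0))" for d
  obtain m where "m > 0" "real m *\<^sub>R axis k 1 \<in> \<Lambda>" using multiple by blast
  then have "P m" unfolding P_def
    by (intro conjI bexI[of _ "real m *\<^sub>R axis k 1"]) (auto simp: axis_def)
  then have L: "P (LEAST d. P d)" by (rule LeastI)
  then obtain u where u: "(LEAST d. P d) > 0" "u \<in> \<Lambda>" "u $ k = real (LEAST d. P d)"
    "\<forall>j. rank k < rank j \<longrightarrow> u $ j = 0" unfolding P_def[of "LEAST d. P d"] by blast
  have "w $ k = 0" if w: "w \<in> \<Lambda>" "\<forall>j. rank k < rank j \<longrightarrow> w $ j = 0" "w $ k \<ge> 0"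
      "w $ k < (LEAST d. P d)" for w
  proof (rule ccontr)
    assume "w $ k \<noteq> 0"
    have "w $ k \<in> \<int>" using w(1) sub by (auto simp: int_points_def)
    then have *: "w $ k = real (nat \<lfloor>w $ k\<rfloor>)" using w(3)
      by (metis Ints_cases floor_of_int of_int_0_le_iff of_nat_nat)
    then have "P (nat \<lfloor>w $ k\<rfloor>)"
      unfolding P_def using w \<open>w $ k \<noteq> 0\<close> by (metis of_nat_0 gr0I)
    then have "(LEAST d. P d) \<le> nat \<lfloor>w $ k\<rfloor>" by (rule Least_le)
    then have "real (LEAST d. P d) \<le> w $ k" by (subst *) (rule of_nat_mono)
    with w(4) show False by simp
  qed
  then show ?thesis using u by blast
qed

text \<open>
  With a triangular basis with diagonal \<open>d\<close>, the integer points of the box with sides \<open>d\<close>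
  represent every class exactly once. Existence: subtracting multiples of the basis vectors brings the
  coordinates into range in order of decreasing rank, and a step does not disturb the coordinates
  already treated. Uniqueness: by minimality of \<open>d\<close>, a difference of two points of the box that lies
  in \<open>\<Lambda>\<close> cannot have a nonzero coordinate of highest rank. The box has as many points as the product
  of the \<open>d\<close>, which is the determinant.
\<close>

lemma residue_system:
  "\<exists>R. is_lattice \<Lambda> \<and> finite R \<and> R \<subseteq> int_points \<and> real (card R) = lattice_det \<Lambda> \<and>
     (\<forall>x\<in>int_points. \<exists>r\<in>R. x - r \<in> \<Lambda>) \<and> (\<forall>r\<in>R. \<forall>r'\<in>R. r - r' \<in> \<Lambda> \<longrightarrow> r = r')"
proof -
  obtain rank :: "'a \<Rightarrow> nat" where rank: "inj rank"
    using finite_imp_inj_to_nat_seg[of "UNIV :: 'a set"] by auto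
  define T where "T k w \<longleftrightarrow> (\<forall>j. rank k < rank j \<longrightarrow> w $ j = 0)" for k and w :: "real^'a"
  have "\<forall>k. \<exists>u d. u \<in> \<Lambda> \<and> d > 0 \<and> u $ k = real d \<and> T k u \<and>
    (\<forall>w\<in>\<Lambda>. T k w \<longrightarrow> w $ k \<ge> 0 \<longrightarrow> w $ k < d \<longrightarrow> w $ k = 0)"
    using triangular_vector[of _ rank] unfolding T_def by blast
  then obtain u :: "'a \<Rightarrow> real^'a" and d :: "'a \<Rightarrow> nat" where
    u: "\<And>k. u k \<in> \<Lambda>" and d: "\<And>k. d k > 0" "\<And>k. u k $ k = real (d k)" and T: "\<And>k. T k (u k)"
    and least: "\<And>k w. w \<in> \<Lambda> \<Longrightarrow> T k w \<Longrightarrow> w $ k \<ge> 0 \<Longrightarrow> w $ k < d k \<Longrightarrow> w $ k = 0"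
    by metis
  define R where "R = {x \<in> int_points. \<forall>i. 0 \<le> x $ i \<and> x $ i < real (d i)}"
  define cmb where "cmb \<alpha> = (\<Sum>i\<in>UNIV. of_int (\<alpha> i) *\<^sub>R u i)" for \<alpha> :: "'a \<Rightarrow> int"
  have cmb: "cmb \<alpha> \<in> \<Lambda>" for \<alpha> unfolding cmb_def by (intro sum_mem of_int_scale u) auto
  have det: "det (\<chi> i. u i) = real (\<Prod>i\<in>UNIV. d i)"
    using det_triangular_rank[OF rank, of "\<chi> i. u i"] T by (simp add: T_def d)
  have unique: "r = r'" if r: "r \<in> R" "r' \<in> R" "r - r' \<in> \<Lambda>" for r r'
  proof (rule ccontr)
    assume "r \<noteq> r'"
    then have ne: "{i. r $ i \<noteq> r' $ i} \<noteq> {}" by (auto simp: vec_eq_iff)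
    then have "Max (rank ` {i. r $ i \<noteq> r' $ i}) \<in> rank ` {i. r $ i \<noteq> r' $ i}"
      by (intro Max_in) auto
    then obtain k where k: "r $ k \<noteq> r' $ k" "rank k = Max (rank ` {i. r $ i \<noteq> r' $ i})"
      by auto
    have kmax: "r $ j = r' $ j" if "rank k < rank j" for j
      using that Max_ge[of "rank ` {i. r $ i \<noteq> r' $ i}" "rank j"]
      unfolding k(2) by (auto simp: not_less[symmetric])
    have "T k (r - r')" "T k (r' - r)" using kmax by (auto simp: T_def)
    moreover have "r' - r \<in> \<Lambda>" using uminus[OF r(3)] by simp
    moreover have "\<bar>r $ k - r' $ k\<bar> < d k"
    proof -
      have "0 \<le> r $ k" "r $ k < d k" "0 \<le> r' $ k" "r' $ k < d k" using r(1,2) by (auto simp: R_def)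
      then show ?thesis by linarith
    qed
    ultimately show False using least[of "r - r'" k] least[of "r' - r" k] k(1) r(3)
      by (cases "r $ k \<le> r' $ k") auto
  qed
  have reduce: "\<exists>\<alpha>. x - cmb \<alpha> \<in> R" if x: "x \<in> int_points" for x
  proof -
    \<comment> \<open>Downward induction on \<open>m\<close>: the vector of rank \<open>m\<close> corrects its own diagonal coordinate.\<close>
    have step: "\<exists>\<alpha>. \<forall>i. rank i \<ge> m \<longrightarrow> 0 \<le> (x - cmb \<alpha>) $ i \<and> (x - cmb \<alpha>) $ i < real (d i)" for m
    proof -
      obtain M where M: "\<And>i. rank i < M"
        using finite_nat_set_iff_bounded[of "range rank"] by auto
      show ?thesis
      proof (cases "m \<le> M")
        case True
        then show ?thesis
        proof (induction rule: inc_induct)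
          case base
          then show ?case using M by (metis not_le)
        next
          case (step m)
          then obtain \<alpha> where \<alpha>: "\<And>i. rank i \<ge> Suc m \<Longrightarrow>
             0 \<le> (x - cmb \<alpha>) $ i \<and> (x - cmb \<alpha>) $ i < real (d i)" by blast
          show ?case
          proof (cases "\<exists>i. rank i = m")
            case False
            then show ?thesis using \<alpha> by (metis Suc_leI le_neq_implies_less)
          next
            case True
            then obtain k where k: "rank k = m" by blast
            define q where "q = \<lfloor>(x - cmb \<alpha>) $ k / d k\<rfloor>"
            define \<beta> where "\<beta> = \<alpha>(k := \<alpha> k + q)"
            have "cmb \<beta> = (\<Sum>i\<in>UNIV. of_int (\<alpha> i) *\<^sub>R u i + (if i = k then of_int q *\<^sub>R u k else 0))"
              unfolding cmb_def \<beta>_def by (intro sum.cong) (auto simp: scaleR_left_distrib)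
            then have \<beta>: "cmb \<beta> = cmb \<alpha> + of_int q *\<^sub>R u k"
              by (simp add: sum.distrib cmb_def)
            have "0 \<le> (x - cmb \<beta>) $ i \<and> (x - cmb \<beta>) $ i < real (d i)" if i: "rank i \<ge> m" for i
            proof (cases "i = k")
              case True
              have "of_int q \<le> (x - cmb \<alpha>) $ k / d k" "(x - cmb \<alpha>) $ k / d k < of_int q + 1"
                unfolding q_def by linarith+
              then show ?thesis using True d(1)[of k] by (simp add: \<beta> d(2) field_simps)
            next
              case False
              then have "rank i \<noteq> rank k" using rank by (simp add: inj_eq)
              with i k have "rank i > m" by simp
              then show ?thesis using T[of k] \<alpha>[of i] k by (simp add: \<beta> T_def)
            qed
            then show ?thesis by blast
          qed
        qed
      next
        case False
        then show ?thesis using M by (metis not_le less_trans)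
      qed
    qed
    obtain \<alpha> where "\<forall>i. 0 \<le> (x - cmb \<alpha>) $ i \<and> (x - cmb \<alpha>) $ i < real (d i)"
      using step[of 0] by auto
    moreover have "x - cmb \<alpha> \<in> int_points"
      using x cmb[of \<alpha>] sub by (auto simp: int_points_def)
    ultimately show ?thesis unfolding R_def by blast
  qed
  have "0 \<in> R" using d by (auto simp: R_def int_points_def)
  \<comment> \<open>A member of \<open>\<Lambda>\<close> is congruent to \<open>0\<close>, so its reduction is the point \<open>0\<close> of the box.\<close>
  have "\<Lambda> = {(\<Sum>i\<in>UNIV. of_int (\<alpha> i) *\<^sub>R u i) | \<alpha> :: 'a \<Rightarrow> int. True}"
  proof (intro equalityI subsetI)
    fix x assume x: "x \<in> \<Lambda>"
    then obtain \<alpha> where \<alpha>: "x - cmb \<alpha> \<in> R" using reduce sub by blast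
    then have "x - cmb \<alpha> = 0" using \<open>0 \<in> R\<close> x cmb by (intro unique) (auto intro: diff)
    then show "x \<in> {(\<Sum>i\<in>UNIV. of_int (\<alpha> i) *\<^sub>R u i) | \<alpha> :: 'a \<Rightarrow> int. True}"
      unfolding cmb_def by auto
  next
    fix x assume "x \<in> {(\<Sum>i\<in>UNIV. of_int (\<alpha> i) *\<^sub>R u i) | \<alpha> :: 'a \<Rightarrow> int. True}"
    then show "x \<in> \<Lambda>" using cmb unfolding cmb_def by auto
  qed
  moreover have "det (\<chi> i. u i) \<noteq> 0" using d(1) by (simp add: det)
  ultimately have basis: "lattice_basis u \<Lambda>" using lattice_basisI[of u] by simp
  have R: "bij_betw (\<lambda>f. \<chi> i. real (f i)) (\<Pi>\<^sub>E i\<in>UNIV. {..<d i}) R"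
  proof (rule bij_betwI[where g = "\<lambda>x i. nat \<lfloor>x $ i\<rfloor>"])
    show "(\<lambda>x i. nat \<lfloor>x $ i\<rfloor>) \<in> R \<rightarrow> (\<Pi>\<^sub>E i\<in>UNIV. {..<d i})"
      by (auto simp: R_def nat_less_iff floor_less_iff)
    show "(\<chi> i. real (nat \<lfloor>x $ i\<rfloor>)) = x" if "x \<in> R" for x
      using that by (auto simp: R_def int_points_def vec_eq_iff of_nat_nat elim!: Ints_cases)
  qed (auto simp: R_def int_points_def)
  have "card R = (\<Prod>i\<in>UNIV. d i)"
    using bij_betw_same_card[OF R] by (simp add: card_PiE)
  then have "real (card R) = lattice_det \<Lambda>"
    unfolding lattice_det_eq[OF basis] det by (simp add: abs_prod)
  moreover have "finite R"
    using bij_betw_finite[OF R] by (simp add: finite_PiE)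
  moreover have "is_lattice \<Lambda>" using basis by (auto simp: is_lattice_def)
  moreover have "\<exists>r\<in>R. x - r \<in> \<Lambda>" if "x \<in> int_points" for x
    using reduce[OF that] cmb by (metis diff_diff_eq2 add_diff_cancel_left')
  ultimately show ?thesis using unique by (intro exI[of _ R]) (auto simp: R_def)
qed

end

section \<open>Subgroups covered by a dilated simplex\<close>

definition simplex_points :: "nat \<Rightarrow> (real^'n::finite) set" where
  "simplex_points h = {x \<in> int_points. (\<forall>i. 0 \<le> x $ i) \<and> (\<Sum>i\<in>UNIV. x $ i) \<le> real h}"

lemma simplex_points_subset_grid:
  "(simplex_points h :: (real^'n::finite) set) \<subseteq> (\<lambda>f. \<chi> i. real (f i)) ` (\<Pi>\<^sub>E i\<in>UNIV. {..h})"
proof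
  fix x :: "real^'n" assume x: "x \<in> simplex_points h"
  have le: "x $ i \<le> real h" for i
  proof -
    have "x $ i \<le> (\<Sum>i\<in>UNIV. x $ i)"
      using x by (intro member_le_sum) (auto simp: simplex_points_def)
    then show ?thesis using x by (simp add: simplex_points_def)
  qed
  have "x = (\<chi> i. real (nat \<lfloor>x $ i\<rfloor>))"
    using x by (auto simp: simplex_points_def int_points_def vec_eq_iff of_nat_nat elim!: Ints_cases)
  moreover have "(\<lambda>i. nat \<lfloor>x $ i\<rfloor>) \<in> (\<Pi>\<^sub>E i\<in>UNIV. {..h})"
    using order.strict_trans1[OF le less_add_one] by (auto simp: nat_le_iff floor_le_iff)
  ultimately show "x \<in> (\<lambda>f. \<chi> i. real (f i)) ` (\<Pi>\<^sub>E i\<in>UNIV. {..h})" by (rule image_eqI)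
qed

lemma finite_simplex_points: "finite (simplex_points h)"
  by (rule finite_subset[OF simplex_points_subset_grid]) (simp add: finite_PiE)

lemma card_simplex_points_le: "card (simplex_points h :: (real^'n::finite) set) \<le> (h + 1) ^ CARD('n)"
proof -
  have "card (simplex_points h :: (real^'n) set) \<le> card ((\<Pi>\<^sub>E i\<in>(UNIV::'n set). {..h}))"
    by (rule surj_card_le[OF _ simplex_points_subset_grid]) (simp add: finite_PiE)
  then show ?thesis by (simp add: card_PiE)
qed

locale simplex_covered_subgroup = integer_subgroup \<Lambda> for \<Lambda> :: "(real^'n::finite) set" +
  fixes h :: nat
  assumes cover: "x \<in> int_points \<Longrightarrow> \<exists>y\<in>simplex_points h. x - y \<in> \<Lambda>"

text \<open>
  The dilated simplex has only finitely many integer points, so by the pigeonhole principle two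
  multiples of a unit vector are congruent to the same one; their difference is a member of \<open>\<Lambda>\<close>.
\<close>

sublocale simplex_covered_subgroup \<subseteq> integer_lattice
proof
  fix i :: 'n
  have "\<forall>k\<in>UNIV. \<exists>y\<in>simplex_points h. real k *\<^sub>R axis i 1 - y \<in> \<Lambda>"
    by (intro ballI cover) (auto simp: int_points_def axis_def)
  from pigeonhole_infinite_rel[OF infinite_UNIV_nat finite_simplex_points this]
  obtain y where y: "infinite {k\<in>UNIV. real k *\<^sub>R axis i 1 - y \<in> \<Lambda>}" by auto
  then obtain k where k: "real k *\<^sub>R axis i 1 - y \<in> \<Lambda>" by (auto dest: not_finite_existsD)
  obtain k' where k': "k' > k" "real k' *\<^sub>R axis i 1 - y \<in> \<Lambda>"
    using y unfolding infinite_nat_iff_unbounded by blast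
  have "real (k' - k) *\<^sub>R axis i 1 \<in> \<Lambda>"
    using diff[OF k'(2) k] k'(1) by (simp add: of_nat_diff scaleR_left_diff_distrib)
  then show "\<exists>k>0. real k *\<^sub>R axis i 1 \<in> \<Lambda>" using k'(1) by (metis zero_less_diff)
qed

context simplex_covered_subgroup
begin

text \<open>
  Every class contains an integer point of the dilated simplex, so the index is at most the
  number of these points. The bound matters only through its leading term \<open>h\<^sup>n\<close>: it keeps the
  determinants of covering lattices bounded.
\<close>

lemma lattice_det_le: "lattice_det \<Lambda> \<le> real ((h + 1) ^ CARD('n))"
proof -
  obtain R where R: "R \<subseteq> int_points" "real (card R) = lattice_det \<Lambda>"
    and unique: "\<And>r r'. r \<in> R \<Longrightarrow> r' \<in> R \<Longrightarrow> r - r' \<in> \<Lambda> \<Longrightarrow> r = r'"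
    using residue_system by blast
  have "\<forall>r\<in>R. \<exists>y\<in>simplex_points h. r - y \<in> \<Lambda>" using cover R(1) by blast
  then obtain y where y: "\<And>r. r \<in> R \<Longrightarrow> y r \<in> simplex_points h \<and> r - y r \<in> \<Lambda>" by metis
  have "inj_on y R"
  proof (rule inj_onI)
    fix r r' assume "r \<in> R" "r' \<in> R" "y r = y r'"
    then show "r = r'" using diff[of "r - y r" "r' - y r'"] y[of r] y[of r'] by (intro unique) auto
  qed
  then have "card R \<le> card (simplex_points h :: (real^'n) set)"
    using y finite_simplex_points by (intro card_inj_on_le) auto
  then have "card R \<le> (h + 1) ^ CARD('n)" using card_simplex_points_le le_trans by blast
  then show ?thesis unfolding R(2)[symmetric] by (rule of_nat_mono)
qed

text \<open>
  A real point is an integer point plus a vector of the unit cube, and the unit cube lies in the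
  simplex of size \<open>n\<close>. Hence the simplex of size \<open>h + n\<close> covers space with \<open>\<Lambda>\<close>, and both can be scaled
  down by \<open>h + n\<close>.
\<close>

lemma scaled_lattice_covering:
  "\<exists>L :: (real^'n) set. is_lattice L \<and> lattice_covering simplex_body L \<and>
     lattice_det \<Lambda> = lattice_det L * real (h + CARD('n)) ^ CARD('n)"
proof -
  define c where "c = real (h + CARD('n))"
  have c: "c > 0" by (simp add: c_def add_nonneg_pos)
  obtain u where u: "lattice_basis u \<Lambda>"
    using residue_system by (auto simp: is_lattice_def)
  define w where "w i = (1 / c) *\<^sub>R u i" for i
  define L where "L = {(\<Sum>i\<in>UNIV. of_int (\<alpha> i) *\<^sub>R w i) | \<alpha> :: 'n \<Rightarrow> int. True}"
  have comb: "(\<Sum>i\<in>UNIV. of_int (\<alpha> i) *\<^sub>R w i) = (1 / c) *\<^sub>R (\<Sum>i\<in>UNIV. of_int (\<alpha> i) *\<^sub>R u i)"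
    for \<alpha> :: "'n \<Rightarrow> int"
    by (simp add: w_def scaleR_right.sum)
  have L: "(1 / c) *\<^sub>R x \<in> L" if "x \<in> \<Lambda>" for x
  proof -
    obtain \<alpha> :: "'n \<Rightarrow> int" where "x = (\<Sum>i\<in>UNIV. of_int (\<alpha> i) *\<^sub>R u i)"
      using u \<open>x \<in> \<Lambda>\<close> by (auto simp: lattice_basis_def)
    then have "(1 / c) *\<^sub>R x = (\<Sum>i\<in>UNIV. of_int (\<alpha> i) *\<^sub>R w i)" by (simp only: comb)
    then show ?thesis unfolding L_def by blast
  qed
  have "det (\<chi> i. w i) = (\<Prod>i\<in>(UNIV::'n set). 1 / c) * det (\<chi> i. u i)"
    unfolding w_def using det_rows_mul[of "\<lambda>_. 1 / c" u]
    by (simp only: scalar_mult_eq_scaleR)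
  then have det: "det (\<chi> i. u i) = det (\<chi> i. w i) * c ^ CARD('n)"
    using c by (simp add: power_one_over field_simps)
  then have w: "lattice_basis w L"
    using lattice_basis_det_nonzero[OF u] unfolding L_def by (intro lattice_basisI) auto
  have "z \<in> (\<Union>x\<in>L. (\<lambda>y. y + x) ` simplex_body)" for z
  proof -
    define f where "f = (\<chi> i. real_of_int \<lfloor>c * z $ i\<rfloor>)"
    have "f \<in> int_points" by (simp add: f_def int_points_def)
    then obtain y where y: "y \<in> simplex_points h" "f - y \<in> \<Lambda>" using cover by blast
    define b where "b = (1 / c) *\<^sub>R (y + (c *\<^sub>R z - f))"
    have frac: "0 \<le> (c *\<^sub>R z - f) $ i" "(c *\<^sub>R z - f) $ i \<le> 1" for i
      unfolding f_def by (simp, simp) linarith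
    have "(\<Sum>i\<in>UNIV. (c *\<^sub>R z - f) $ i) \<le> (\<Sum>i\<in>(UNIV::'n set). 1)" by (intro sum_mono frac)
    moreover have "(\<Sum>i\<in>UNIV. y $ i) \<le> h" using y(1) by (simp add: simplex_points_def)
    ultimately have "(\<Sum>i\<in>UNIV. (y + (c *\<^sub>R z - f)) $ i) \<le> c"
      unfolding vector_add_component sum.distrib c_def by simp
    then have "b \<in> simplex_body"
      using y(1) c frac
      by (auto simp: b_def simplex_body_def simplex_points_def sum_divide_distrib[symmetric] intro!: divide_nonneg_pos add_nonneg_nonneg)
    moreover have "z = b + (1 / c) *\<^sub>R (f - y)"
      using c by (simp add: b_def algebra_simps)
    ultimately show ?thesis using L[OF y(2)] by blast
  qed
  then have "lattice_covering simplex_body L" by (auto simp: lattice_covering_def)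
  moreover have "lattice_det \<Lambda> = lattice_det L * c ^ CARD('n)"
    unfolding lattice_det_eq[OF u] lattice_det_eq[OF w] det using c by (simp add: abs_mult)
  ultimately show ?thesis using w unfolding is_lattice_def c_def by blast
qed

end

section \<open>Bases of groups and subgroups of the integer points\<close>

text \<open>
  The subgroup is the kernel of the homomorphism \<open>\<phi>\<close> that sends the \<open>i\<close>th unit vector to
  \<open>c\<^sub>i - c\<^sub>0\<close>. Writing an element translated by \<open>h c\<^sub>0\<close> as a sum of \<open>h\<close> basis elements and counting how
  often each \<open>c\<^sub>i\<close> with \<open>i \<noteq> 0\<close> occurs expresses the element itself as the image of an integer point
  of the simplex of size \<open>h\<close>; the occurrences of \<open>c\<^sub>0\<close> contribute nothing.
\<close>

lemma h_basis_kernel: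
  fixes G (structure)
  assumes "comm_group G" "finite (carrier G)" "h_basis G h C" "card C = CARD('n::finite) + 1"
  shows "\<exists>\<Lambda> :: (real^'n) set. simplex_covered_subgroup \<Lambda> h \<and> real (card (carrier G)) = lattice_det \<Lambda>"
proof -
  interpret comm_group G by fact
  have C: "C \<subseteq> carrier G"
    and rep: "\<And>g. g \<in> carrier G \<Longrightarrow> \<exists>c\<in>{1..h} \<rightarrow> C. g = finprod G c {1..h}"
    using assms(3) by (auto simp: h_basis_def)
  have finC: "finite C" using assms(4) by (simp add: card_ge_0_finite)
  obtain c0 where c0: "c0 \<in> C" using assms(4) by fastforce
  then have "card (C - {c0}) = CARD('n)" using assms(4) by simp
  then obtain c :: "'n \<Rightarrow> 'a" where c: "bij_betw c UNIV (C - {c0})"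
    using finite_same_card_bij[of "UNIV :: 'n set" "C - {c0}"] finC by auto
  have c0G: "c0 \<in> carrier G" using c0 C by auto
  have cG: "c i \<in> carrier G" for i using c C by (auto simp: bij_betw_def)
  define a where "a i = c i \<otimes> inv c0" for i
  have a: "a i \<in> carrier G" for i using cG c0G by (simp add: a_def)
  define \<phi> :: "real^'n \<Rightarrow> 'a" where "\<phi> x = finprod G (\<lambda>i. a i [^] \<lfloor>x $ i\<rfloor>) UNIV" for x
  have \<phi>: "\<phi> x \<in> carrier G" for x unfolding \<phi>_def by (intro finprod_closed) (auto simp: a)
  have \<phi>0: "\<phi> 0 = \<one>" unfolding \<phi>_def by simp
  have add: "\<phi> (x + y) = \<phi> x \<otimes> \<phi> y" if "y \<in> int_points" for x y
  proof -
    have "\<lfloor>(x + y) $ i\<rfloor> = \<lfloor>x $ i\<rfloor> + \<lfloor>y $ i\<rfloor>" for i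
      using that by (auto simp: int_points_def floor_add2)
    then have "\<phi> (x + y) = finprod G (\<lambda>i. a i [^] \<lfloor>x $ i\<rfloor> \<otimes> a i [^] \<lfloor>y $ i\<rfloor>) UNIV"
      unfolding \<phi>_def by (simp add: int_pow_mult a)
    also have "\<dots> = \<phi> x \<otimes> \<phi> y" unfolding \<phi>_def by (subst finprod_multf) (auto simp: a)
    finally show ?thesis .
  qed
  have eq_iff: "\<phi> (x - y) = \<one> \<longleftrightarrow> \<phi> x = \<phi> y" if "y \<in> int_points" for x y
    using add[OF that, of "x - y"] \<phi>[of y] \<phi>[of "x - y"] by simp
  have axis: "\<phi> (axis i 1) = a i" for i
  proof -
    have "\<phi> (axis i 1) = finprod G (\<lambda>j. if i = j then a j else \<one>) UNIV"
      unfolding \<phi>_def by (intro finprod_cong') (auto simp: axis_def a)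
    also have "\<dots> = a i" by (rule finprod_singleton) (auto simp: a)
    finally show ?thesis .
  qed
  have sums: "\<exists>y\<in>simplex_points (card J). finprod G (\<lambda>j. f j \<otimes> inv c0) J = \<phi> y"
    if "finite J" "f \<in> J \<rightarrow> C" for J :: "nat set" and f
    using that
  proof (induction J rule: finite_induct)
    case empty
    then show ?case using \<phi>0
      by (intro bexI[of _ 0]) (auto simp: simplex_points_def int_points_def)
  next
    case (insert j J)
    then obtain y where y: "y \<in> simplex_points (card J)"
      "finprod G (\<lambda>j. f j \<otimes> inv c0) J = \<phi> y" by auto
    have prod: "finprod G (\<lambda>j. f j \<otimes> inv c0) (insert j J) = (f j \<otimes> inv c0) \<otimes> \<phi> y"
      using insert.hyps insert.prems C c0G by (subst finprod_insert) (auto simp: y(2)[symmetric])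
    have yi: "y \<in> int_points" using y(1) by (simp add: simplex_points_def)
    show ?case
    proof (cases "f j = c0")
      case True
      then have "finprod G (\<lambda>j. f j \<otimes> inv c0) (insert j J) = \<phi> y"
        using prod c0G \<phi> by simp
      moreover have "y \<in> simplex_points (card (insert j J))"
        using y(1) insert.hyps by (auto simp: simplex_points_def)
      ultimately show ?thesis by blast
    next
      case False
      then have "f j \<in> C - {c0}" using insert.prems by auto
      then obtain i where "f j = c i" using c by (auto simp: bij_betw_def)
      then have "finprod G (\<lambda>j. f j \<otimes> inv c0) (insert j J) = \<phi> (axis i 1 + y)"
        unfolding prod add[OF yi] axis by (simp add: a_def)
      moreover have "axis i 1 + y \<in> simplex_points (card (insert j J))"
        using y(1) insert.hyps
        by (auto simp: simplex_points_def int_points_def sum.distrib axis_def)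
      ultimately show ?thesis by blast
    qed
  qed
  have onto: "\<exists>y\<in>simplex_points h. g = \<phi> y" if g: "g \<in> carrier G" for g
  proof -
    have "g \<otimes> c0 [^] h \<in> carrier G" using g c0G by simp
    then obtain f where f: "f \<in> {1..h} \<rightarrow> C" "g \<otimes> c0 [^] h = finprod G f {1..h}" using rep by blast
    have fG: "f \<in> {1..h} \<rightarrow> carrier G" using f(1) C by auto
    have "finprod G (\<lambda>j. f j \<otimes> inv c0) {1..h} = finprod G f {1..h} \<otimes> finprod G (\<lambda>_. inv c0) {1..h}"
      using fG c0G by (intro finprod_multf) auto
    also have "finprod G (\<lambda>_. inv c0) {1..h} = inv c0 [^] h"
      using finprod_const[of "inv c0" "{1..h}"] c0G by simp
    also have "finprod G f {1..h} \<otimes> inv c0 [^] h = g"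
      unfolding f(2)[symmetric] using g c0G by (simp add: m_assoc nat_pow_inv)
    finally show ?thesis using sums[of "{1..h}" f] f(1) by auto
  qed
  define \<Lambda> where "\<Lambda> = {x \<in> int_points. \<phi> x = \<one>}"
  have int_diff: "x - y \<in> int_points" if "x \<in> int_points" "y \<in> int_points" for x y :: "real^'n"
    using that by (simp add: int_points_def)
  have mem: "x - y \<in> \<Lambda> \<longleftrightarrow> \<phi> x = \<phi> y" if "x \<in> int_points" "y \<in> int_points" for x y
    using that by (simp add: \<Lambda>_def int_diff eq_iff)
  have "simplex_covered_subgroup \<Lambda> h"
  proof
    show "\<Lambda> \<subseteq> int_points" by (auto simp: \<Lambda>_def)
    show "0 \<in> \<Lambda>" using \<phi>0 by (simp add: \<Lambda>_def int_points_def)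
    show "x - y \<in> \<Lambda>" if "x \<in> \<Lambda>" "y \<in> \<Lambda>" for x y
      using that by (subst mem) (auto simp: \<Lambda>_def)
    show "\<exists>y\<in>simplex_points h. x - y \<in> \<Lambda>" if x: "x \<in> int_points" for x
    proof -
      obtain y where "y \<in> simplex_points h" "\<phi> x = \<phi> y" using onto[OF \<phi>] by blast
      with x show ?thesis using mem[of x y] by (auto simp: simplex_points_def)
    qed
  qed
  then interpret simplex_covered_subgroup \<Lambda> h .
  obtain R where R: "R \<subseteq> int_points" "real (card R) = lattice_det \<Lambda>"
    and reach: "\<And>x. x \<in> int_points \<Longrightarrow> \<exists>r\<in>R. x - r \<in> \<Lambda>"
    and unique: "\<And>r r'. r \<in> R \<Longrightarrow> r' \<in> R \<Longrightarrow> r - r' \<in> \<Lambda> \<Longrightarrow> r = r'"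
    using residue_system by blast
  \<comment> \<open>The group is isomorphic to the quotient by the kernel, so its order is the index.\<close>
  have "bij_betw \<phi> R (carrier G)"
    unfolding bij_betw_def
  proof (intro conjI inj_onI equalityI subsetI)
    show "r = r'" if "r \<in> R" "r' \<in> R" "\<phi> r = \<phi> r'" for r r'
      using that unique mem R(1) by blast
    show "g \<in> carrier G" if "g \<in> \<phi> ` R" for g using that \<phi> by auto
    show "g \<in> \<phi> ` R" if g: "g \<in> carrier G" for g
    proof -
      obtain y where y: "y \<in> int_points" "g = \<phi> y"
        using onto[OF g] by (auto simp: simplex_points_def)
      then obtain r where "r \<in> R" "y - r \<in> \<Lambda>" using reach by blast
      with y show ?thesis using mem[of y r] R(1) by auto
    qed
  qed
  then have "card R = card (carrier G)" by (rule bij_betw_same_card)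
  then show ?thesis using R(2) simplex_covered_subgroup_axioms by auto
qed

definition int_points_group :: "(real^'n::finite) monoid" where
  "int_points_group = \<lparr>carrier = int_points, mult = (+), one = 0\<rparr>"

lemma int_points_group_simps [simp]:
  "carrier int_points_group = int_points"
  "mult int_points_group = (+)"
  "one int_points_group = 0"
  by (simp_all add: int_points_group_def)

lemma comm_group_int_points: "comm_group (int_points_group :: (real^'n::finite) monoid)"
proof (rule comm_groupI)
  fix x :: "real^'n" assume "x \<in> carrier int_points_group"
  then show "\<exists>y\<in>carrier int_points_group. y \<otimes>\<^bsub>int_points_group\<^esub> x = \<one>\<^bsub>int_points_group\<^esub>"
    by (intro bexI[of _ "- x"]) (auto simp: int_points_def)
qed (auto simp: int_points_def)

context simplex_covered_subgroup
begin

text \<open>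
  In the quotient, the classes of \<open>0\<close> and of the unit vectors form an \<open>h\<close>-basis. Some of these
  classes may coincide; a superset of a basis is a basis, so they can be padded to exactly \<open>n + 1\<close>
  elements, for which the quotient has to be large enough.
\<close>

lemma lattice_det_le_psi:
  assumes big: "lattice_det \<Lambda> \<ge> real (CARD('n) + 1)"
  shows "lattice_det \<Lambda> \<le> real (psi h CARD('n))"
proof -
  let ?Z = "int_points_group :: (real^'n) monoid"
  interpret Z: comm_group ?Z by (rule comm_group_int_points)
  have inv: "inv\<^bsub>?Z\<^esub> x = - x" if "x \<in> int_points" for x
    using that by (intro Z.inv_equality) (auto simp: int_points_def)
  have subgroup: "subgroup \<Lambda> ?Z"
    using sub by (intro Z.subgroupI) (use zero in \<open>auto simp: inv uminus plus subset_iff\<close>)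
  define Q where "Q = ?Z Mod \<Lambda>"
  interpret N: normal \<Lambda> ?Z using subgroup by (rule Z.subgroup_imp_normal)
  have cQ: "comm_group Q" unfolding Q_def using subgroup by (rule Z.abelian_FactGroup)
  interpret Q: comm_group Q by (rule cQ)
  define \<pi> where "\<pi> x = \<Lambda> #>\<^bsub>?Z\<^esub> x" for x
  have carrier: "carrier Q = \<pi> ` int_points"
    by (auto simp: Q_def \<pi>_def FactGroup_def RCOSETS_def)
  have \<pi>: "\<pi> x \<in> carrier Q" if "x \<in> int_points" for x using that carrier by auto
  have add: "\<pi> (x + y) = \<pi> x \<otimes>\<^bsub>Q\<^esub> \<pi> y" if "x \<in> int_points" "y \<in> int_points" for x y
    using N.rcos_sum[of x y] that by (simp add: Q_def \<pi>_def)
  have one: "\<pi> 0 = \<one>\<^bsub>Q\<^esub>"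
    using sub by (simp add: Q_def \<pi>_def r_coset_def)
  have coset: "\<pi> x = (\<lambda>l. l + x) ` \<Lambda>" for x by (auto simp: \<pi>_def r_coset_def)
  have eq: "\<pi> x = \<pi> y \<longleftrightarrow> x - y \<in> \<Lambda>" for x y
  proof
    assume "\<pi> x = \<pi> y"
    moreover have "x \<in> \<pi> x" using zero by (force simp: coset)
    ultimately show "x - y \<in> \<Lambda>" by (auto simp: coset)
  next
    assume d: "x - y \<in> \<Lambda>"
    have "l + x \<in> \<pi> y" if "l \<in> \<Lambda>" for l
      using plus[OF that d] unfolding coset by (rule rev_image_eqI) simp
    moreover have "l + y \<in> \<pi> x" if "l \<in> \<Lambda>" for l
      using diff[OF that d] unfolding coset by (rule rev_image_eqI) simp
    ultimately show "\<pi> x = \<pi> y" by (auto simp: coset)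
  qed
  obtain R where R: "finite R" "R \<subseteq> int_points" "real (card R) = lattice_det \<Lambda>"
    and reach: "\<And>x. x \<in> int_points \<Longrightarrow> \<exists>r\<in>R. x - r \<in> \<Lambda>"
    and unique: "\<And>r r'. r \<in> R \<Longrightarrow> r' \<in> R \<Longrightarrow> r - r' \<in> \<Lambda> \<Longrightarrow> r = r'"
    using residue_system by blast
  have bij: "bij_betw \<pi> R (carrier Q)"
    unfolding bij_betw_def carrier
  proof (intro conjI inj_onI equalityI subsetI)
    show "r = r'" if "r \<in> R" "r' \<in> R" "\<pi> r = \<pi> r'" for r r'
      using that unique eq by blast
    show "g \<in> \<pi> ` int_points" if "g \<in> \<pi> ` R" for g using that R(2) by auto
    show "g \<in> \<pi> ` R" if "g \<in> \<pi> ` int_points" for g using that reach eq by blast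
  qed
  have finQ: "finite (carrier Q)" using bij_betw_finite[OF bij] R(1) by simp
  have cardQ: "real (card (carrier Q)) = lattice_det \<Lambda>" using bij_betw_same_card[OF bij] R(3) by simp
  have axis_int: "axis i 1 \<in> int_points" for i :: 'n by (auto simp: int_points_def axis_def)
  define C0 where "C0 = insert (\<pi> 0) (range (\<lambda>i. \<pi> (axis i 1)))"
  have "card (range (\<lambda>i. \<pi> (axis i 1))) \<le> CARD('n)" by (rule card_image_le) simp
  then have "card C0 \<le> CARD('n) + 1" unfolding C0_def
    by (intro order.trans[OF card_insert_le_m1]) auto
  moreover have "C0 \<subseteq> carrier Q"
    unfolding C0_def using axis_int by (auto intro!: \<pi>) (simp add: int_points_def)
  moreover have "CARD('n) + 1 \<le> card (carrier Q)" using big cardQ by linarith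
  ultimately obtain C where C: "C0 \<subseteq> C" "C \<subseteq> carrier Q" "card C = CARD('n) + 1"
    using exists_subset_between[of C0 "CARD('n) + 1" "carrier Q"] finQ by metis
  have sums: "\<exists>f\<in>{1..k} \<rightarrow> C0. \<pi> y = finprod Q f {1..k}" if "y \<in> simplex_points k" for k y
    using that
  proof (induction k arbitrary: y)
    case 0
    then have "(\<Sum>i\<in>UNIV. y $ i) = 0" "\<And>i. y $ i \<ge> 0"
      by (auto simp: simplex_points_def intro: antisym sum_nonneg)
    then have "y = 0" by (simp add: sum_nonneg_eq_0_iff vec_eq_iff)
    then show ?case by (simp add: one)
  next
    case (Suc k)
    have "\<exists>z\<in>simplex_points k. \<exists>g\<in>C0. \<pi> y = g \<otimes>\<^bsub>Q\<^esub> \<pi> z"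
    proof (cases "\<exists>i. y $ i \<noteq> 0")
      case False
      then have "y = 0" by (simp add: vec_eq_iff)
      then show ?thesis
        by (intro bexI[of _ 0] bexI[of _ "\<pi> 0"]) (auto simp: C0_def one simplex_points_def int_points_def)
    next
      case True
      then obtain i where i: "y $ i \<noteq> 0" by blast
      have y: "y \<in> int_points" "\<And>j. 0 \<le> y $ j" "(\<Sum>j\<in>UNIV. y $ j) \<le> real (Suc k)"
        using Suc.prems by (auto simp: simplex_points_def)
      have "1 \<le> y $ i"
        using i y(1) y(2)[of i] Ints_nonzero_abs_ge1[of "y $ i"] by (simp add: int_points_def)
      then have z: "y - axis i 1 \<in> simplex_points k"
        using y by (auto simp: simplex_points_def int_points_def axis_def sum_subtractf)
      then have "\<pi> y = \<pi> (axis i 1) \<otimes>\<^bsub>Q\<^esub> \<pi> (y - axis i 1)"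
        using add[OF axis_int, of "y - axis i 1" i] by (simp add: simplex_points_def)
      with z show ?thesis unfolding C0_def by blast
    qed
    then obtain z g where z: "z \<in> simplex_points k" "g \<in> C0" "\<pi> y = g \<otimes>\<^bsub>Q\<^esub> \<pi> z" by blast
    obtain f where f: "f \<in> {1..k} \<rightarrow> C0" "\<pi> z = finprod Q f {1..k}" using Suc.IH[OF z(1)] by blast
    define f' where "f' = f(Suc k := g)"
    have sub': "C0 \<subseteq> carrier Q" using C by auto
    have "finprod Q f' {1..k} = finprod Q f {1..k}"
      using f(1) sub' by (intro Q.finprod_cong') (auto simp: f'_def)
    moreover have "finprod Q f' (insert (Suc k) {1..k}) = f' (Suc k) \<otimes>\<^bsub>Q\<^esub> finprod Q f' {1..k}"
      using f(1) z(2) sub' by (intro Q.finprod_insert) (auto simp: f'_def)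
    ultimately have "\<pi> y = finprod Q f' {1..Suc k}"
      using z(3) f(2) by (simp add: f'_def atLeastAtMostSuc_conv)
    moreover have "f' \<in> {1..Suc k} \<rightarrow> C0" using f(1) z(2) by (auto simp: f'_def)
    ultimately show ?case by blast
  qed
  have "h_basis Q h C"
    unfolding h_basis_def
  proof (intro conjI ballI)
    fix g assume "g \<in> carrier Q"
    then obtain x where x: "x \<in> int_points" "g = \<pi> x" using carrier by auto
    then obtain y where "y \<in> simplex_points h" "g = \<pi> y" using cover eq by blast
    then show "\<exists>c\<in>{1..h} \<rightarrow> C. g = finprod Q c {1..h}" using sums[of y h] C(1) by blast
  qed (rule C)
  then have "card (carrier Q) \<le> psi h CARD('n)" using card_le_psi[OF cQ finQ] C(3) by blast
  then show ?thesis unfolding cardQ[symmetric] by (rule of_nat_mono)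
qed

end

section \<open>Rounding a covering lattice\<close>

lemma transpose_mult_combination:
  fixes v :: "'n::finite \<Rightarrow> real^'n"
  shows "transpose (\<chi> i. v i) *v t = (\<Sum>i\<in>UNIV. (t $ i) *\<^sub>R v i)"
  by (simp add: matrix_mult_sum column_def transpose_def scalar_mult_eq_scaleR vec_lambda_eta)

lemma combination_exists:
  fixes v :: "'n::finite \<Rightarrow> real^'n"
  assumes "det (\<chi> i. v i) \<noteq> 0"
  shows "\<exists>t. x = (\<Sum>i\<in>UNIV. (t $ i) *\<^sub>R v i)"
proof -
  let ?A = "transpose (\<chi> i. v i)"
  have "invertible ?A" using assms by (simp add: invertible_det_nz)
  then obtain A' where "?A ** A' = mat 1" unfolding invertible_def by blast
  then have "x = ?A *v (A' *v x)" by (simp add: matrix_vector_mul_assoc)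
  then show ?thesis unfolding transpose_mult_combination by blast
qed

text \<open>
  An injective linear map is bounded below. The bound \<open>2\<close> leaves room for a point of the unit simplex
  translated by a vector with coordinates in the unit interval.
\<close>

lemma coefficients_bounded:
  fixes v :: "'n::finite \<Rightarrow> real^'n"
  assumes "det (\<chi> i. v i) \<noteq> 0"
  shows "\<exists>B>0. \<forall>s. (\<forall>j. \<bar>(\<Sum>i\<in>UNIV. (s $ i) *\<^sub>R v i) $ j\<bar> \<le> 2) \<longrightarrow> (\<Sum>i\<in>UNIV. \<bar>s $ i\<bar>) \<le> B"
proof -
  let ?A = "transpose (\<chi> i. v i)"
  let ?n = "real CARD('n)"
  have "invertible ?A" using assms by (simp add: invertible_det_nz)
  then have "inj ((*v) ?A)" by (rule inj_matrix_vector_mult)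
  then obtain c where c: "c > 0" "\<And>s. c * norm s \<le> norm (?A *v s)"
    using linear_inj_bounded_below_pos[of "(*v) ?A"] by auto
  have "(\<Sum>i\<in>UNIV. \<bar>s $ i\<bar>) \<le> ?n * (2 * ?n / c)" if s: "\<And>j. \<bar>(?A *v s) $ j\<bar> \<le> 2" for s
  proof -
    have "norm (?A *v s) \<le> (\<Sum>j\<in>UNIV. \<bar>(?A *v s) $ j\<bar>)" by (rule norm_le_l1_cart)
    also have "\<dots> \<le> (\<Sum>j\<in>(UNIV::'n set). 2)" by (intro sum_mono s)
    finally have "c * norm s \<le> 2 * ?n" using c(2)[of s] by simp
    then have "norm s \<le> 2 * ?n / c" using c(1) by (simp add: field_simps)
    then have "\<bar>s $ i\<bar> \<le> 2 * ?n / c" for i using component_le_norm_cart[of s i] by linarith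
    then have "(\<Sum>i\<in>UNIV. \<bar>s $ i\<bar>) \<le> (\<Sum>i\<in>(UNIV::'n set). 2 * ?n / c)" by (intro sum_mono)
    then show ?thesis by simp
  qed
  moreover have "?n * (2 * ?n / c) > 0" using c(1) by simp
  ultimately show ?thesis unfolding transpose_mult_combination by blast
qed

definition round_vec :: "real^'n::finite \<Rightarrow> real^'n" where
  "round_vec x = (\<chi> j. of_int (round (x $ j)))"

text \<open>
  Here \<open>m\<close> is the real number to which the simplex shrinks to make room for the rounding.
  Expand an integer point \<open>x\<close> in the rounded basis \<open>w\<close> with real coefficients \<open>t\<close>, and locate the
  point with the same coefficients with respect to \<open>v\<close>, up to a small shift, in a translate of the
  simplex by the vector of \<open>L\<close> with coefficients \<open>\<alpha>\<close>. The remainder \<open>y\<close> of \<open>x\<close> after subtracting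
  the vector with coefficients \<open>\<alpha>\<close> in the rounded lattice is an integer point. It differs from \<open>m\<close>
  times a point of the shifted simplex by an error whose coordinates are at most the sum of the
  absolute values of \<open>t - \<alpha>\<close>, and \<open>coefficients_bounded\<close> bounds this sum by a constant \<open>B\<close>. The shift
  contributes \<open>B\<close> to each coordinate, so that \<open>y\<close> is nonnegative; shift and error together cost
  \<open>2 n B\<close> in the coordinate sum.
\<close>

lemma rounded_lattice_covers:
  fixes v :: "'n::finite \<Rightarrow> real^'n"
  assumes basis: "lattice_basis v L" and cov: "lattice_covering simplex_body L"
  shows "\<exists>B>0. \<forall>h m. m \<ge> B \<longrightarrow> real h = m + 2 * real CARD('n) * B \<longrightarrow>
    det (\<chi> i. round_vec (m *\<^sub>R v i)) \<noteq> 0 \<longrightarrow>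
    simplex_covered_subgroup {(\<Sum>i\<in>UNIV. of_int (\<alpha> i) *\<^sub>R round_vec (m *\<^sub>R v i)) | \<alpha> :: 'n \<Rightarrow> int. True} h"
proof -
  obtain B where B: "B > 0"
    "\<And>s. (\<And>j. \<bar>(\<Sum>i\<in>UNIV. (s $ i) *\<^sub>R v i) $ j\<bar> \<le> 2) \<Longrightarrow> (\<Sum>i\<in>UNIV. \<bar>s $ i\<bar>) \<le> B"
    using coefficients_bounded[OF lattice_basis_det_nonzero[OF basis]] by blast
  have "simplex_covered_subgroup {(\<Sum>i\<in>UNIV. of_int (\<alpha> i) *\<^sub>R round_vec (m *\<^sub>R v i)) | \<alpha> :: 'n \<Rightarrow> int. True} h"
    if m: "m \<ge> B" and h: "real h = m + 2 * real CARD('n) * B"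
      and det: "det (\<chi> i. round_vec (m *\<^sub>R v i)) \<noteq> 0" for h m
  proof -
    define w where "w i = round_vec (m *\<^sub>R v i)" for i
    define \<Lambda> where "\<Lambda> = {(\<Sum>i\<in>UNIV. of_int (\<alpha> i) *\<^sub>R w i) | \<alpha> :: 'n \<Rightarrow> int. True}"
    have m0: "m > 0" using B(1) m by simp
    have w_int: "w i $ j \<in> \<int>" for i j by (simp add: w_def round_vec_def)
    have sub: "\<Lambda> \<subseteq> int_points"
      by (auto simp: \<Lambda>_def int_points_def w_int intro!: Ints_sum Ints_mult)
    have "simplex_covered_subgroup \<Lambda> h"
    proof
      show "\<Lambda> \<subseteq> int_points" by (rule sub)
      show "0 \<in> \<Lambda>" unfolding \<Lambda>_def by (auto intro!: exI[of _ "\<lambda>_. 0"])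
      show "x - y \<in> \<Lambda>" if xy: "x \<in> \<Lambda>" "y \<in> \<Lambda>" for x y
      proof -
        obtain \<alpha> \<beta> :: "'n \<Rightarrow> int" where "x = (\<Sum>i\<in>UNIV. of_int (\<alpha> i) *\<^sub>R w i)" "y = (\<Sum>i\<in>UNIV. of_int (\<beta> i) *\<^sub>R w i)"
          using xy by (auto simp: \<Lambda>_def)
        then have "x - y = (\<Sum>i\<in>UNIV. of_int (\<alpha> i - \<beta> i) *\<^sub>R w i)"
          by (simp add: sum_subtractf scaleR_left_diff_distrib)
        then show ?thesis unfolding \<Lambda>_def by (intro CollectI exI[of _ "\<lambda>i. \<alpha> i - \<beta> i"]) simp
      qed
      show "\<exists>y\<in>simplex_points h. x - y \<in> \<Lambda>" if x: "x \<in> int_points" for x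
      proof -
        obtain t where t: "x = (\<Sum>i\<in>UNIV. (t $ i) *\<^sub>R w i)"
          using combination_exists[of w x] det by (auto simp: w_def)
        define one :: "real^'n" where "one = (\<chi> j. 1)"
        define p where "p = (\<Sum>i\<in>UNIV. (t $ i) *\<^sub>R v i) - (B / m) *\<^sub>R one"
        have "p \<in> (\<Union>x\<in>L. (\<lambda>y. y + x) ` simplex_body)" using cov by (simp add: lattice_covering_def)
        then obtain b l where b: "b \<in> simplex_body" "l \<in> L" "p = b + l" by auto
        then obtain \<alpha> :: "'n \<Rightarrow> int" where \<alpha>: "p = b + (\<Sum>i\<in>UNIV. of_int (\<alpha> i) *\<^sub>R v i)"
          using basis by (auto simp: lattice_basis_def)
        define s where "s = (\<chi> i. t $ i - of_int (\<alpha> i))"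
        have sv: "(\<Sum>i\<in>UNIV. (s $ i) *\<^sub>R v i) = b + (B / m) *\<^sub>R one"
          using \<alpha> unfolding p_def s_def by (simp add: sum_subtractf scaleR_left_diff_distrib algebra_simps)
        have b0: "0 \<le> b $ j" for j using b(1) by (simp add: simplex_body_def)
        have bsum: "(\<Sum>j\<in>UNIV. b $ j) \<le> 1" using b(1) by (simp add: simplex_body_def)
        have b1: "b $ j \<le> 1" for j
          using member_le_sum[of j UNIV "\<lambda>j. b $ j"] b0 bsum by simp
        have sB: "(\<Sum>i\<in>UNIV. \<bar>s $ i\<bar>) \<le> B"
        proof (rule B(2))
          fix j
          have "0 \<le> B / m" "B / m \<le> 1" using B(1) m m0 by (auto simp: field_simps)
          then show "\<bar>(\<Sum>i\<in>UNIV. (s $ i) *\<^sub>R v i) $ j\<bar> \<le> 2"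
            unfolding sv using b0[of j] b1[of j] by (simp add: one_def)
        qed
        define e where "e = (\<Sum>i\<in>UNIV. (s $ i) *\<^sub>R (w i - m *\<^sub>R v i))"
        define y where "y = (\<Sum>i\<in>UNIV. (s $ i) *\<^sub>R w i)"
        have "y = e + m *\<^sub>R (\<Sum>i\<in>UNIV. (s $ i) *\<^sub>R v i)"
          unfolding y_def e_def scaleR_right.sum sum.distrib[symmetric]
          by (intro sum.cong) (auto simp: algebra_simps)
        then have y: "y $ j = e $ j + m * b $ j + B" for j
          using m0 unfolding sv by (simp add: one_def algebra_simps)
        have e: "\<bar>e $ j\<bar> \<le> B" for j
        proof -
          have "\<bar>e $ j\<bar> \<le> (\<Sum>i\<in>UNIV. \<bar>s $ i\<bar> * \<bar>w i $ j - m * v i $ j\<bar>)"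
            unfolding e_def by (simp add: sum_abs abs_mult[symmetric])
          also have "\<dots> \<le> (\<Sum>i\<in>UNIV. \<bar>s $ i\<bar> * 1)"
          proof (intro sum_mono mult_left_mono)
            fix i show "\<bar>w i $ j - m * v i $ j\<bar> \<le> 1"
              using of_int_round_abs_le[of "m * v i $ j"] by (simp add: w_def round_vec_def)
          qed auto
          finally show ?thesis using sB by simp
        qed
        have xy: "x - y = (\<Sum>i\<in>UNIV. of_int (\<alpha> i) *\<^sub>R w i)"
          unfolding y_def t s_def by (simp add: sum_subtractf scaleR_left_diff_distrib)
        then have mem: "x - y \<in> \<Lambda>" unfolding \<Lambda>_def by blast
        then have "x - (x - y) \<in> int_points"
          using x sub unfolding int_points_def by (auto simp del: diff_diff_eq2)
        then have "y \<in> int_points" by simp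
        moreover have "0 \<le> y $ j" for j
          using y[of j] e[of j] mult_nonneg_nonneg[OF less_imp_le[OF m0] b0[of j]] by linarith
        moreover have "(\<Sum>j\<in>UNIV. y $ j) \<le> real h"
        proof -
          have "(\<Sum>j\<in>UNIV. y $ j) \<le> (\<Sum>j\<in>UNIV. m * b $ j + 2 * B)"
            using y e by (intro sum_mono) (smt (verit))
          also have "\<dots> = m * (\<Sum>j\<in>UNIV. b $ j) + 2 * real CARD('n) * B"
            by (simp add: sum.distrib sum_distrib_left)
          also have "\<dots> \<le> m * 1 + 2 * real CARD('n) * B"
            using bsum m0 by (intro add_right_mono mult_left_mono) auto
          finally show ?thesis using h by simp
        qed
        ultimately show ?thesis using mem by (auto simp: simplex_points_def)
      qed
    qed
    then show ?thesis unfolding \<Lambda>_def w_def .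
  qed
  then show ?thesis using B(1) by blast
qed

lemma det_rounded_tendsto:
  fixes v :: "'n::finite \<Rightarrow> real^'n" and b :: real
  shows "(\<lambda>h. \<bar>det (\<chi> i. round_vec ((real h - b) *\<^sub>R v i))\<bar> / real h ^ CARD('n))
    \<longlonglongrightarrow> \<bar>det (\<chi> i. v i)\<bar>"
proof -
  have entry: "(\<lambda>h. of_int (round ((real h - b) * x)) / real h) \<longlonglongrightarrow> x" for x :: real
  proof -
    have "(\<lambda>h. (of_int (round ((real h - b) * x)) - (real h - b) * x) / real h) \<longlonglongrightarrow> 0"
    proof (rule Lim_null_comparison)
      show "\<forall>\<^sub>F h in sequentially.
          norm ((of_int (round ((real h - b) * x)) - (real h - b) * x) / real h) \<le> 1 / real h"
      proof (intro always_eventually allI)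
        fix h
        have "\<bar>of_int (round ((real h - b) * x)) - (real h - b) * x\<bar> \<le> 1"
          using of_int_round_abs_le[of "(real h - b) * x"] by linarith
        then show "norm ((of_int (round ((real h - b) * x)) - (real h - b) * x) / real h) \<le> 1 / real h"
          by (simp add: divide_right_mono)
      qed
    qed (rule lim_1_over_n)
    moreover have "(\<lambda>h. x - b * x * (1 / real h)) \<longlonglongrightarrow> x"
      by (auto intro!: tendsto_eq_intros lim_1_over_n)
    ultimately have "(\<lambda>h. (of_int (round ((real h - b) * x)) - (real h - b) * x) / real h
        + (x - b * x * (1 / real h))) \<longlonglongrightarrow> 0 + x"
      by (rule tendsto_add)
    then have "(\<lambda>h. of_int (round ((real h - b) * x)) / real h) \<longlonglongrightarrow> 0 + x"
      by (rule Lim_transform_eventually)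
        (rule eventually_sequentiallyI[of 1], simp add: field_simps)
    then show ?thesis by simp
  qed
  have "(\<lambda>h. det ((\<chi> i. (1 / real h) *\<^sub>R round_vec ((real h - b) *\<^sub>R v i)) :: real^'n^'n)) \<longlonglongrightarrow> det (\<chi> i. v i)"
    unfolding det_def
    by (intro tendsto_sum tendsto_mult tendsto_const tendsto_prod) (use entry in \<open>simp add: round_vec_def\<close>)
  moreover have "det ((\<chi> i. (1 / real h) *\<^sub>R round_vec ((real h - b) *\<^sub>R v i)) :: real^'n^'n)
      = det (\<chi> i. round_vec ((real h - b) *\<^sub>R v i)) / real h ^ CARD('n)" for h
    using det_rows_mul[of "\<lambda>_. 1 / real h" "\<lambda>i. round_vec ((real h - b) *\<^sub>R v i)"]
    unfolding scalar_mult_eq_scaleR by (simp add: power_one_over)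
  ultimately have "(\<lambda>h. det (\<chi> i. round_vec ((real h - b) *\<^sub>R v i)) / real h ^ CARD('n))
      \<longlonglongrightarrow> det (\<chi> i. v i)"
    by simp
  from tendsto_rabs[OF this] show ?thesis by simp
qed

text \<open>
  \<open>D h\<close> is the determinant of the rounded lattice. It tends to infinity, so eventually it is
  nonzero and large enough for the quotient group to have \<open>n + 1\<close> elements.
\<close>

lemma det_approximated_below_psi:
  fixes v :: "'n::finite \<Rightarrow> real^'n"
  assumes basis: "lattice_basis v L" and cov: "lattice_covering simplex_body L"
  shows "\<exists>D. (\<lambda>h. D h / real h ^ CARD('n)) \<longlonglongrightarrow> lattice_det L \<and>
    (\<forall>\<^sub>F h in sequentially. D h \<le> real (psi h CARD('n)) \<and> D h \<le> real (h + 1) ^ CARD('n))"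
proof -
  let ?n = "CARD('n)"
  obtain B where B: "B > 0" "\<And>h m. m \<ge> B \<Longrightarrow> real h = m + 2 * real ?n * B \<Longrightarrow>
      det (\<chi> i. round_vec (m *\<^sub>R v i)) \<noteq> 0 \<Longrightarrow>
      simplex_covered_subgroup {(\<Sum>i\<in>UNIV. of_int (\<alpha> i) *\<^sub>R round_vec (m *\<^sub>R v i)) | \<alpha> :: 'n \<Rightarrow> int. True} h"
    using rounded_lattice_covers[OF basis cov] by blast
  define b where "b = 2 * real ?n * B"
  define D where "D h = \<bar>det (\<chi> i. round_vec ((real h - b) *\<^sub>R v i))\<bar>" for h
  have lim: "(\<lambda>h. D h / real h ^ ?n) \<longlonglongrightarrow> lattice_det L"
    using det_rounded_tendsto[of b v] lattice_det_eq[OF basis] by (simp add: D_def)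
  have pos: "lattice_det L > 0"
    using lattice_det_eq[OF basis] lattice_basis_det_nonzero[OF basis] by simp
  have "filterlim (\<lambda>h. real h ^ ?n) at_top sequentially"
    by (intro filterlim_pow_at_top filterlim_real_sequentially) simp
  with lim pos have "filterlim (\<lambda>h. D h / real h ^ ?n * real h ^ ?n) at_top sequentially"
    by (rule filterlim_tendsto_pos_mult_at_top)
  then have "\<forall>\<^sub>F h in sequentially. D h / real h ^ ?n * real h ^ ?n \<ge> real (?n + 1)"
    unfolding filterlim_at_top by blast
  moreover have "\<forall>\<^sub>F h in sequentially. real h \<ge> b + B"
    using filterlim_real_sequentially unfolding filterlim_at_top by blast
  ultimately have "\<forall>\<^sub>F h in sequentially. D h \<le> real (psi h ?n) \<and> D h \<le> real (h + 1) ^ ?n"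
    using eventually_gt_at_top[of 0]
  proof eventually_elim
    case (elim h)
    define w where "w i = round_vec ((real h - b) *\<^sub>R v i)" for i
    let ?\<Lambda> = "{(\<Sum>i\<in>UNIV. of_int (\<alpha> i) *\<^sub>R w i) | \<alpha> :: 'n \<Rightarrow> int. True}"
    have big: "D h \<ge> real (?n + 1)" using elim by simp
    then have det: "det (\<chi> i. w i) \<noteq> 0" unfolding D_def w_def by auto
    interpret simplex_covered_subgroup ?\<Lambda> h
      using B(2)[of "real h - b" h] elim det by (simp add: w_def b_def)
    have D: "lattice_det ?\<Lambda> = D h"
      using lattice_det_eq[OF lattice_basisI[OF det]] by (simp add: D_def w_def)
    show ?case using lattice_det_le lattice_det_le_psi big unfolding D by simp
  qed
  with lim show ?thesis by blast
qed

section \<open>The limit\<close>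

lemma measure_simplex_body: "measure lebesgue (simplex_body :: (real^'n::finite) set) = 1 / fact CARD('n)"
proof -
  have "(simplex_body :: (real^'n) set) = convex hull (insert 0 Basis)"
  proof -
    have B: "(Basis :: (real^'n) set) = range (\<lambda>i. axis i 1)" by (auto simp: Basis_vec_def)
    have "(\<Sum>b\<in>Basis. x \<bullet> b) = (\<Sum>i\<in>UNIV. x $ i)" for x :: "real^'n"
      unfolding B by (subst sum.reindex) (auto simp: inj_on_def axis_eq_axis inner_axis)
    then show ?thesis
      unfolding std_simplex simplex_body_def by (auto simp: B inner_axis)
  qed
  moreover have "convex hull (insert 0 Basis :: (real^'n) set) \<in> sets lborel"
    by (simp add: compact_imp_closed finite_imp_compact_convex_hull borel_closed)
  ultimately show ?thesis
    using content_std_simplex[where 'a = "real^'n"] by (simp add: measure_completion)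
qed

theorem theorem3p2:
  shows "(\<lambda>h. real (psi h CARD('n::finite)) / real h ^ CARD('n))
           \<longlonglongrightarrow> 1 / (fact CARD('n) * lattice_covering_density (simplex_body :: (real^'n) set))"
proof -
  let ?n = "CARD('n)" and ?K = "simplex_body :: (real^'n) set"
  define \<D> where "\<D> = {lattice_det L | L :: (real^'n) set. is_lattice L \<and> lattice_covering ?K L}"
  \<comment> \<open>\<open>M\<close> turns out to be the supremum of \<open>\<D>\<close>: see \<open>le_M\<close> and \<open>near_M\<close>.\<close>
  define M where "M = 1 / (fact ?n * lattice_covering_density ?K)"
  have pos: "d > 0" if d: "d \<in> \<D>" for d
  proof -
    obtain L :: "(real^'n) set" and v where "d = lattice_det L" "lattice_basis v L"
      using d by (auto simp: \<D>_def is_lattice_def)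
    then show ?thesis using lattice_det_eq[of v L] lattice_basis_det_nonzero[of v L] by simp
  qed
  have approx: "\<exists>D. (\<lambda>h. D h / real h ^ ?n) \<longlonglongrightarrow> d \<and>
      (\<forall>\<^sub>F h in sequentially. D h \<le> real (psi h ?n) \<and> D h \<le> real (h + 1) ^ ?n)" if "d \<in> \<D>" for d
    using that det_approximated_below_psi unfolding \<D>_def is_lattice_def by blast
  have ratio: "(\<lambda>h. real (h + k) ^ ?n / real h ^ ?n) \<longlonglongrightarrow> 1" for k :: nat
  proof -
    have "(\<lambda>h. (1 + real k * (1 / real h)) ^ ?n) \<longlonglongrightarrow> 1"
      by (auto intro!: tendsto_eq_intros lim_1_over_n)
    then show ?thesis
    proof (rule Lim_transform_eventually, intro eventually_sequentiallyI[of 1])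
      fix h :: nat assume "h \<ge> 1"
      then have "1 + real k * (1 / real h) = real (h + k) / real h" by (simp add: field_simps)
      then show "(1 + real k * (1 / real h)) ^ ?n = real (h + k) ^ ?n / real h ^ ?n"
        by (simp only: power_divide)
    qed
  qed
  have le1: "d \<le> 1" if d: "d \<in> \<D>" for d
  proof -
    obtain D where D: "(\<lambda>h. D h / real h ^ ?n) \<longlonglongrightarrow> d"
      "\<forall>\<^sub>F h in sequentially. D h \<le> real (psi h ?n) \<and> D h \<le> real (h + 1) ^ ?n"
      using approx[OF d] by blast
    show ?thesis
    proof (rule tendsto_le[OF _ ratio[of 1] D(1)])
      show "\<forall>\<^sub>F h in sequentially. D h / real h ^ ?n \<le> real (h + 1) ^ ?n / real h ^ ?n"
        using D(2) by eventually_elim (simp add: divide_right_mono)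
    qed simp
  qed
  have upper: "\<exists>d\<in>\<D>. real (psi h ?n) = d * real (h + ?n) ^ ?n" if "h > 0" for h
  proof -
    have "psi h ?n \<in> psi_set h ?n"
      unfolding psi_def using finite_psi_set psi_set_nonempty[OF that] by (rule Max_in)
    then obtain G :: "nat monoid" and C where G: "comm_group G" "finite (carrier G)" "h_basis G h C"
      "card C = ?n + 1" "psi h ?n = card (carrier G)"
      unfolding psi_set_def by blast
    obtain \<Lambda> :: "(real^'n) set" where \<Lambda>: "simplex_covered_subgroup \<Lambda> h"
      "real (card (carrier G)) = lattice_det \<Lambda>"
      using h_basis_kernel[OF G(1-4)] by blast
    then show ?thesis
      using simplex_covered_subgroup.scaled_lattice_covering[OF \<Lambda>(1)] \<Lambda>(2) G(5) unfolding \<D>_def by auto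
  qed
  have "\<D> \<noteq> {}" using upper[of 1] by auto
  have dens: "{covering_density ?K L | L. is_lattice L \<and> lattice_covering ?K L} = (\<lambda>d. 1 / fact ?n / d) ` \<D>"
    unfolding covering_density_def measure_simplex_body \<D>_def by blast
  define \<theta> where "\<theta> = lattice_covering_density ?K"
  have \<theta>: "\<theta> = (INF d\<in>\<D>. 1 / fact ?n / d)"
    unfolding \<theta>_def lattice_covering_density_def dens ..
  \<comment> \<open>Without \<open>\<theta> > 0\<close>, the quotient \<open>M\<close> would be \<open>0\<close> by the convention for division by zero.\<close>
  have "1 / fact ?n \<le> 1 / fact ?n / d" if "d \<in> \<D>" for d
    using pos[OF that] le1[OF that] by (simp add: field_simps)
  then have "1 / fact ?n \<le> \<theta>"
    unfolding \<theta> using \<open>\<D> \<noteq> {}\<close> by (intro cINF_greatest)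
  then have \<theta>0: "\<theta> > 0" by (rule less_le_trans[rotated]) simp
  have M: "M = 1 / (fact ?n * \<theta>)" by (simp add: M_def \<theta>_def)
  have bdd: "bdd_below ((\<lambda>d. 1 / fact ?n / d) ` \<D>)"
    using pos by (intro bdd_belowI[of _ 0]) (auto intro: less_imp_le)
  have le_M: "d \<le> M" if "d \<in> \<D>" for d
    using cINF_lower[OF bdd that] pos[OF that] \<theta>0 unfolding \<theta>[symmetric] M by (simp add: field_simps)
  have near_M: "\<exists>d\<in>\<D>. x < d" if "x < M" for x
  proof (rule ccontr)
    assume "\<not> (\<exists>d\<in>\<D>. x < d)"
    then have le: "d \<le> x" if "d \<in> \<D>" for d using that by force
    then have x: "x > 0" using \<open>\<D> \<noteq> {}\<close> pos by (meson ex_in_conv less_le_trans)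
    have "1 / fact ?n / x \<le> 1 / fact ?n / d" if "d \<in> \<D>" for d
      using le[OF that] pos[OF that] by (intro divide_left_mono) auto
    then have "1 / fact ?n / x \<le> \<theta>"
      unfolding \<theta> using \<open>\<D> \<noteq> {}\<close> by (intro cINF_greatest)
    with \<open>x < M\<close> x \<theta>0 show False unfolding M by (simp add: field_simps)
  qed
  have "(\<lambda>h. real (psi h ?n) / real h ^ ?n) \<longlonglongrightarrow> M"
  proof (rule order_tendstoI)
    fix x assume "x < M"
    then obtain d where d: "d \<in> \<D>" "x < d" using near_M by blast
    then obtain D where D: "(\<lambda>h. D h / real h ^ ?n) \<longlonglongrightarrow> d"
      "\<forall>\<^sub>F h in sequentially. D h \<le> real (psi h ?n) \<and> D h \<le> real (h + 1) ^ ?n"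
      using approx by blast
    show "\<forall>\<^sub>F h in sequentially. x < real (psi h ?n) / real h ^ ?n"
      using order_tendstoD(1)[OF D(1) d(2)] D(2)
    proof eventually_elim
      case (elim h)
      then have "D h / real h ^ ?n \<le> real (psi h ?n) / real h ^ ?n"
        by (intro divide_right_mono) auto
      with elim(1) show ?case by linarith
    qed
  next
    fix x assume "M < x"
    have "(\<lambda>h. M * (real (h + ?n) ^ ?n / real h ^ ?n)) \<longlonglongrightarrow> M * 1"
      by (intro tendsto_mult tendsto_const ratio)
    then have "\<forall>\<^sub>F h in sequentially. M * (real (h + ?n) ^ ?n / real h ^ ?n) < x"
      using \<open>M < x\<close> by (intro order_tendstoD) auto
    then show "\<forall>\<^sub>F h in sequentially. real (psi h ?n) / real h ^ ?n < x"
      using eventually_gt_at_top[of 0]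
    proof eventually_elim
      case (elim h)
      obtain d where d: "d \<in> \<D>" "real (psi h ?n) = d * real (h + ?n) ^ ?n"
        using upper elim(2) by blast
      have "real (psi h ?n) / real h ^ ?n \<le> M * (real (h + ?n) ^ ?n / real h ^ ?n)"
        unfolding d(2) times_divide_eq_right using le_M[OF d(1)]
        by (intro divide_right_mono mult_right_mono) auto
      with elim(1) show ?case by linarith
    qed
  qed
  then show ?thesis unfolding M_def .
qed

end
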